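(* The logic $\mathsf{GS4}$ has the finite birelational frame property: for every formula $\varphi$ of $\mathcal L$, if $\varphi$ is falsifiable (respectively satisfiable) on some $\mathsf{GS4}$ frame, then $\varphi$ is falsifiable (respectively satisfiable) on some finite $\mathsf{GS4}$ frame.
   Context: Fix a countably infinite set $\mathbb P$ of propositional variables. The language $\mathcal L$ is given by $\varphi ::= p \mid \bot \mid (\varphi\wedge\varphi)\mid(\varphi\vee\varphi)\mid(\varphi\to\varphi)\mid\Diamond\varphi\mid\Box\varphi$ with $p\in\mathbb P$. A bi-intuitionistic frame is a tuple $(W,W^\bot,\preccurlyeq,\sqsubseteq)$ where $\preccurlyeq,\sqsubseteq$ are preorders on the set $W$ and $W^\bot\subseteq W$ is closed upward under both; it is infallible if $W^\bot=\varnothing$ (then written $(W,\preccurlyeq,\sqsubseteq)$). It is forth--up confluent if whenever $w\preccurlyeq w'$ and $w\sqsubseteq v$ there is $v'$ with $v\preccurlyeq v'$ and $w'\sqsubseteq v'$; back--up confluent if whenever $w\sqsubseteq v\preccurlyeq v'$ there is $w'$ with $w\preccurlyeq w'\sqsubseteq v'$; upward linear if $w\preccurlyeq u$ and $w\preccurlyeq v$ imply $u\preccurlyeq v$ or $v\preccurlyeq u$. A $\mathsf{GS4}$ frame is an infallible bi-intuitionistic frame that is forth--up confluent, back--up confluent and upward linear. A valuation on a frame is a map $V:\mathbb P\to 2^W$ with each $V(p)$ upward closed under $\preccurlyeq$ and containing $W^\bot$. Satisfaction: $w\models p$ iff $w\in V(p)$; $w\models\bot$ iff $w\in W^\bot$;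 $\wedge,\vee$ pointwise; $w\models\varphi\to\psi$ iff for all $v\succcurlyeq w$, $v\models\varphi$ implies $v\models\psi$; $w\models\Diamond\varphi$ iff for all $u\succcurlyeq w$ there is $v$ with $u\sqsubseteq v$ and $v\models\varphi$; $w\models\Box\varphi$ iff for all $u,v$ with $w\preccurlyeq u\sqsubseteq v$, $v\models\varphi$. $\varphi$ is falsifiable on a frame if for some valuation some world not in $W^\bot$ fails to satisfy $\varphi$; satisfiable if for some valuation some world not in $W^\bot$ satisfies $\varphi$. A frame is finite if $W$ is finite. *)

theory Defs
  imports Main "HOL-Library.Countable" "HOL-Library.Infinite_Typeclass"
begin

datatype 'p fm =
    Var 'p
  | Bot  (\<open>\<^bold>\<bottom>\<close>)
  | And "'p fm" "'p fm"  (infixr \<open>\<^bold>\<and>\<close> 65)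
  | Or "'p fm" "'p fm"  (infixr \<open>\<^bold>\<or>\<close> 60)
  | Imp "'p fm" "'p fm"  (infixr \<open>\<^bold>\<rightarrow>\<close> 55)
  | Dia "'p fm"  (\<open>\<^bold>\<diamond>_\<close> [70] 70)
  | Box "'p fm"  (\<open>\<^bold>\<box>_\<close> [70] 70)

text \<open>
  The carrier is a set of worlds, not a whole type. The relation \<open>le\<close> is the intuitionistic
  preorder and \<open>acc\<close> the modal one; both are confined to the carrier by the library's
  \<open>preorder_on\<close>.
\<close>

record 'w frame =
  worlds :: "'w set"
  fallible :: "'w set"
  le :: "'w rel"
  acc :: "'w rel"

definition up_closed :: "'w rel \<Rightarrow> 'w set \<Rightarrow> bool" where
  "up_closed r A \<longleftrightarrow> (\<forall>w v. w \<in> A \<and> (w, v) \<in> r \<longrightarrow> v \<in> A)"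

definition bi_intuitionistic_frame :: "'w frame \<Rightarrow> bool" where
  "bi_intuitionistic_frame F \<longleftrightarrow>
     preorder_on (worlds F) (le F) \<and> preorder_on (worlds F) (acc F) \<and>
     fallible F \<subseteq> worlds F \<and> up_closed (le F) (fallible F) \<and> up_closed (acc F) (fallible F)"

definition infallible :: "'w frame \<Rightarrow> bool" where
  "infallible F \<longleftrightarrow> fallible F = {}"

definition forth_up_confluent :: "'w frame \<Rightarrow> bool" where
  "forth_up_confluent F \<longleftrightarrow>
     (\<forall>w w' v. (w, w') \<in> le F \<and> (w, v) \<in> acc F \<longrightarrow> (\<exists>v'. (v, v') \<in> le F \<and> (w', v') \<in> acc F))"

definition back_up_confluent :: "'w frame \<Rightarrow> bool" where
  "back_up_confluent F \<longleftrightarrow>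
     (\<forall>w v v'. (w, v) \<in> acc F \<and> (v, v') \<in> le F \<longrightarrow> (\<exists>w'. (w, w') \<in> le F \<and> (w', v') \<in> acc F))"

definition upward_linear :: "'w frame \<Rightarrow> bool" where
  "upward_linear F \<longleftrightarrow>
     (\<forall>w u v. (w, u) \<in> le F \<and> (w, v) \<in> le F \<longrightarrow> (u, v) \<in> le F \<or> (v, u) \<in> le F)"

definition GS4_frame :: "'w frame \<Rightarrow> bool" where
  "GS4_frame F \<longleftrightarrow> bi_intuitionistic_frame F \<and> infallible F \<and>
     forth_up_confluent F \<and> back_up_confluent F \<and> upward_linear F"

definition valuation :: "'w frame \<Rightarrow> ('p \<Rightarrow> 'w set) \<Rightarrow> bool" where
  "valuation F V \<longleftrightarrow>
     (\<forall>p. V p \<subseteq> worlds F \<and> up_closed (le F) (V p) \<and> fallible F \<subseteq> V p)"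

primrec sat :: "'w frame \<Rightarrow> ('p \<Rightarrow> 'w set) \<Rightarrow> 'w \<Rightarrow> 'p fm \<Rightarrow> bool" where
  "sat F V w (Var p) \<longleftrightarrow> w \<in> V p"
| "sat F V w \<^bold>\<bottom> \<longleftrightarrow> w \<in> fallible F"
| "sat F V w (\<phi> \<^bold>\<and> \<psi>) \<longleftrightarrow> sat F V w \<phi> \<and> sat F V w \<psi>"
| "sat F V w (\<phi> \<^bold>\<or> \<psi>) \<longleftrightarrow> sat F V w \<phi> \<or> sat F V w \<psi>"
| "sat F V w (\<phi> \<^bold>\<rightarrow> \<psi>) \<longleftrightarrow> (\<forall>v. (w, v) \<in> le F \<longrightarrow> sat F V v \<phi> \<longrightarrow> sat F V v \<psi>)"
| "sat F V w (\<^bold>\<diamond>\<phi>) \<longleftrightarrow> (\<forall>u. (w, u) \<in> le F \<longrightarrow> (\<exists>v. (u, v) \<in> acc F \<and> sat F V v \<phi>))"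
| "sat F V w (\<^bold>\<box>\<phi>) \<longleftrightarrow> (\<forall>u v. (w, u) \<in> le F \<and> (u, v) \<in> acc F \<longrightarrow> sat F V v \<phi>)"

definition falsifiable_on :: "'w frame \<Rightarrow> 'p fm \<Rightarrow> bool" where
  "falsifiable_on F \<phi> \<longleftrightarrow>
     (\<exists>V. valuation F V \<and> (\<exists>w \<in> worlds F - fallible F. \<not> sat F V w \<phi>))"

definition satisfiable_on :: "'w frame \<Rightarrow> 'p fm \<Rightarrow> bool" where
  "satisfiable_on F \<phi> \<longleftrightarrow>
     (\<exists>V. valuation F V \<and> (\<exists>w \<in> worlds F - fallible F. sat F V w \<phi>))"

definition finite_frame :: "'w frame \<Rightarrow> bool" where
  "finite_frame F \<longleftrightarrow> finite (worlds F)"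

end

(* Fix the finite set of subformulas of the given formula. In a model on an upward linear frame,
   the subformula types of the worlds above w form a chain L w, and L w has only finitely many
   possible values. Identify worlds with the same chain. Since L v is a final segment of L w
   whenever v lies above w, and every final segment arises so, the collapse is a bounded morphism
   for the intuitionistic relation. The image of the modal relation satisfies both confluence
   conditions but need not be transitive; its transitive closure still does, and it keeps the
   truth values because truth of a box persists forward along the modal relation and truth of a
   diamond persists backward. *)

theory Submission
  imports Defs
begin

section \<open>Subformulas\<close>

primrec subformulas :: "'p fm \<Rightarrow> 'p fm set" where
  "subformulas (Var p) = {Var p}"
| "subformulas \<^bold>\<bottom> = {\<^bold>\<bottom>}"
| "subformulas (\<phi> \<^bold>\<and> \<psi>) = insert (\<phi> \<^bold>\<and> \<psi>) (subformulas \<phi> \<union> subformulas \<psi>)"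
| "subformulas (\<phi> \<^bold>\<or> \<psi>) = insert (\<phi> \<^bold>\<or> \<psi>) (subformulas \<phi> \<union> subformulas \<psi>)"
| "subformulas (\<phi> \<^bold>\<rightarrow> \<psi>) = insert (\<phi> \<^bold>\<rightarrow> \<psi>) (subformulas \<phi> \<union> subformulas \<psi>)"
| "subformulas (\<^bold>\<diamond>\<phi>) = insert (\<^bold>\<diamond>\<phi>) (subformulas \<phi>)"
| "subformulas (\<^bold>\<box>\<phi>) = insert (\<^bold>\<box>\<phi>) (subformulas \<phi>)"

lemma finite_subformulas: "finite (subformulas \<phi>)"
  by (induction \<phi>) auto

lemma self_in_subformulas: "\<phi> \<in> subformulas \<phi>"
  by (cases \<phi>) auto

lemma subformulas_trans: "\<psi> \<in> subformulas \<phi> \<Longrightarrow> subformulas \<psi> \<subseteq> subformulas \<phi>"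
  by (induction \<phi>) auto

section \<open>Persistence and the modal clauses in a GS4 model\<close>

locale GS4_model =
  fixes F :: "'w frame" and V :: "'p \<Rightarrow> 'w set"
  assumes GS4: "GS4_frame F" and val: "valuation F V"
begin

lemma le_refl: "w \<in> worlds F \<Longrightarrow> (w, w) \<in> le F"
  and acc_refl: "w \<in> worlds F \<Longrightarrow> (w, w) \<in> acc F"
  and le_trans: "(u, v) \<in> le F \<Longrightarrow> (v, w) \<in> le F \<Longrightarrow> (u, w) \<in> le F"
  and acc_trans: "(u, v) \<in> acc F \<Longrightarrow> (v, w) \<in> acc F \<Longrightarrow> (u, w) \<in> acc F"
  and le_worlds: "(u, v) \<in> le F \<Longrightarrow> u \<in> worlds F \<and> v \<in> worlds F"
  and acc_worlds: "(u, v) \<in> acc F \<Longrightarrow> u \<in> worlds F \<and> v \<in> worlds F"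
  and no_fallible: "fallible F = {}"
  using GS4
  unfolding GS4_frame_def bi_intuitionistic_frame_def infallible_def preorder_on_def refl_on_def trans_def
  by blast+

lemma forth_up:
  assumes "(w, w') \<in> le F" "(w, v) \<in> acc F"
  obtains v' where "(v, v') \<in> le F" "(w', v') \<in> acc F"
  using GS4 assms unfolding GS4_frame_def forth_up_confluent_def by blast

lemma back_up:
  assumes "(w, v) \<in> acc F" "(v, v') \<in> le F"
  obtains w' where "(w, w') \<in> le F" "(w', v') \<in> acc F"
  using GS4 assms unfolding GS4_frame_def back_up_confluent_def by blast

lemma linear: "(w, u) \<in> le F \<Longrightarrow> (w, v) \<in> le F \<Longrightarrow> (u, v) \<in> le F \<or> (v, u) \<in> le F"
  using GS4 unfolding GS4_frame_def upward_linear_def by blast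

lemma sat_mono: "sat F V w \<psi> \<Longrightarrow> (w, v) \<in> le F \<Longrightarrow> sat F V v \<psi>"
proof (induction \<psi> arbitrary: w v)
  case (Var p)
  then show ?case using val unfolding valuation_def up_closed_def by auto
qed (auto simp: no_fallible dest: le_trans)

text \<open>Forth--up confluence transports a witness at \<open>w\<close> to every world above
  \<open>w\<close>, and persistence keeps \<open>\<psi>\<close> true at the transported
  witness.\<close>

lemma sat_Dia:
  assumes "w \<in> worlds F"
  shows "sat F V w (\<^bold>\<diamond>\<psi>) \<longleftrightarrow> (\<exists>v. (w, v) \<in> acc F \<and> sat F V v \<psi>)"
proof
  assume "\<exists>v. (w, v) \<in> acc F \<and> sat F V v \<psi>"
  then show "sat F V w (\<^bold>\<diamond>\<psi>)" unfolding sat.simps by (meson forth_up sat_mono)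
qed (use assms le_refl in auto)

lemma sat_Dia_acc_back: "(w, v) \<in> acc F \<Longrightarrow> sat F V v (\<^bold>\<diamond>\<psi>) \<Longrightarrow> sat F V w (\<^bold>\<diamond>\<psi>)"
  using sat_Dia acc_trans acc_worlds by blast

text \<open>For a path that goes from \<open>v\<close> up to some \<open>u\<close> and then modally
  to some \<open>x\<close>, back--up confluence yields a world above \<open>w\<close> that sees
  \<open>u\<close>, and hence \<open>x\<close> by transitivity.\<close>

lemma sat_Box_acc: "(w, v) \<in> acc F \<Longrightarrow> sat F V w (\<^bold>\<box>\<psi>) \<Longrightarrow> sat F V v (\<^bold>\<box>\<psi>)"
  unfolding sat.simps by (meson back_up acc_trans)

lemma sat_Box_self: "w \<in> worlds F \<Longrightarrow> sat F V w (\<^bold>\<box>\<psi>) \<Longrightarrow> sat F V w \<psi>"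
  by (auto dest: le_refl acc_refl)

end

section \<open>Types, chains of types and their codes\<close>

locale GS4_filtration = GS4_model F V
  for F :: "'w frame" and V :: "'p \<Rightarrow> 'w set" +
  fixes \<Sigma> :: "'p fm set"
  assumes finite_\<Sigma>: "finite \<Sigma>"
    and \<Sigma>_closed: "\<psi> \<in> \<Sigma> \<Longrightarrow> subformulas \<psi> \<subseteq> \<Sigma>"
begin

definition type_of :: "'w \<Rightarrow> 'p fm set" where
  "type_of w = {\<psi> \<in> \<Sigma>. sat F V w \<psi>}"

text \<open>Identifying worlds by type alone would be too coarse: worlds of equal type may see
  different types above them, which breaks the back condition for the intuitionistic
  relation.\<close>

definition chain_of :: "'w \<Rightarrow> 'p fm set set" where
  "chain_of w = {type_of v |v. (w, v) \<in> le F}"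

lemma type_of_mono: "(w, v) \<in> le F \<Longrightarrow> type_of w \<subseteq> type_of v"
  using sat_mono unfolding type_of_def by blast

text \<open>By persistence the type of \<open>w\<close> is the least member of its chain, so the
  chain determines the truth at \<open>w\<close> of every formula in
  \<open>\<Sigma>\<close>.\<close>

lemma type_of_eq_Inter: "w \<in> worlds F \<Longrightarrow> type_of w = \<Inter> (chain_of w)"
  using type_of_mono le_refl unfolding chain_of_def by blast

lemma chain_of_final_segment:
  assumes "(w, v) \<in> le F"
  shows "chain_of v = {T \<in> chain_of w. type_of v \<subseteq> T}"
proof
  show "chain_of v \<subseteq> {T \<in> chain_of w. type_of v \<subseteq> T}"
    using assms le_trans type_of_mono unfolding chain_of_def by blast
  show "{T \<in> chain_of w. type_of v \<subseteq> T} \<subseteq> chain_of v"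
  proof clarify
    fix T assume "T \<in> chain_of w" and sub: "type_of v \<subseteq> T"
    then obtain u where u: "(w, u) \<in> le F" "T = type_of u"
      unfolding chain_of_def by blast
    show "T \<in> chain_of v"
    proof (cases "(v, u) \<in> le F")
      case True
      then show ?thesis using u unfolding chain_of_def by blast
    next
      case False
      \<comment> \<open>This is where upward linearity enters: if \<open>u\<close> is not above
        \<open>v\<close>, it lies below \<open>v\<close>, and persistence with \<open>sub\<close>
        forces the two types to coincide.\<close>
      then have "(u, v) \<in> le F" using linear assms u by blast
      then have "T = type_of v" using type_of_mono u sub by blast
      then show ?thesis using le_refl le_worlds assms unfolding chain_of_def by blast
    qed
  qed
qed

text \<open>A final segment is determined by the chain and its least type. Any \<open>v\<close>
  above \<open>w\<close> with the type of \<open>v'\<close> therefore has the chain of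
  \<open>v'\<close>.\<close>

lemma chain_of_back:
  assumes "chain_of w = chain_of w'" "(w', v') \<in> le F"
  obtains v where "(w, v) \<in> le F" "chain_of v = chain_of v'"
proof -
  have "type_of v' \<in> chain_of w"
    using assms unfolding chain_of_def by blast
  then obtain v where v: "(w, v) \<in> le F" "type_of v = type_of v'"
    unfolding chain_of_def by auto
  then have "chain_of v = chain_of v'"
    using chain_of_final_segment assms by simp
  with v that show ?thesis by blast
qed

lemma finite_chains: "finite (chain_of ` worlds F)"
proof (rule finite_subset)
  show "chain_of ` worlds F \<subseteq> Pow (Pow \<Sigma>)"
    unfolding chain_of_def type_of_def by blast
qed (use finite_\<Sigma> in simp)

text \<open>Numbering the finitely many chains by an arbitrary injection makes natural numbers the
  worlds of the collapse, whatever the type of the original worlds.\<close>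

definition code :: "'w \<Rightarrow> nat" where
  "code w = (SOME g. inj_on g (chain_of ` worlds F)) (chain_of w)"

lemma code_eq_iff:
  assumes "w \<in> worlds F" "w' \<in> worlds F"
  shows "code w = code w' \<longleftrightarrow> chain_of w = chain_of w'"
proof -
  have "\<exists>g :: 'p fm set set \<Rightarrow> nat. inj_on g (chain_of ` worlds F)"
    using finite_imp_inj_to_nat_seg[OF finite_chains] by blast
  from someI_ex[OF this] show ?thesis
    using assms unfolding code_def by (simp add: inj_on_eq_iff)
qed

lemma code_back:
  assumes "w \<in> worlds F" "code w = code w'" "(w', v') \<in> le F"
  obtains v where "(w, v) \<in> le F" "code v = code v'"
  using assms chain_of_back code_eq_iff le_worlds by metis

lemma sat_cong_code:
  assumes "w \<in> worlds F" "w' \<in> worlds F" "code w = code w'" "\<psi> \<in> \<Sigma>"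
  shows "sat F V w \<psi> \<longleftrightarrow> sat F V w' \<psi>"
proof -
  have "type_of w = type_of w'"
    using assms code_eq_iff type_of_eq_Inter by simp
  then show ?thesis using assms unfolding type_of_def by blast
qed

section \<open>The collapsed frame and its confluence\<close>

definition le_image :: "nat rel" where
  "le_image = {(code w, code v) |w v. (w, v) \<in> le F}"

definition acc_image :: "nat rel" where
  "acc_image = {(code w, code v) |w v. (w, v) \<in> acc F}"

text \<open>The closure is transitive but not reflexive by construction; reflexivity on the codes is
  inherited from \<open>acc F\<close>.\<close>

definition collapse :: "nat frame" where
  "collapse = \<lparr>worlds = code ` worlds F, fallible = {}, le = le_image, acc = acc_image\<^sup>+\<rparr>"

text \<open>Only variables in \<open>\<Sigma>\<close> are sure to have a truth value invariant under
  \<open>code\<close>; all others are made false everywhere.\<close>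

definition collapse_val :: "'p \<Rightarrow> nat set" where
  "collapse_val p = {code w |w. w \<in> V p \<and> Var p \<in> \<Sigma>}"

lemma collapse_simps [simp]:
  "worlds collapse = code ` worlds F" "fallible collapse = {}"
  "le collapse = le_image" "acc collapse = acc_image\<^sup>+"
  by (simp_all add: collapse_def)

lemma le_imageE:
  assumes "(a, b) \<in> le_image"
  obtains w v where "(w, v) \<in> le F" "a = code w" "b = code v"
  using assms unfolding le_image_def by blast

text \<open>The representative of the source can be prescribed, by \<open>code_back\<close>. This
  allows intuitionistic steps to be composed and attached to chosen modal steps.\<close>

lemma le_imageD:
  assumes "(code w, b) \<in> le_image" "w \<in> worlds F"
  obtains v where "(w, v) \<in> le F" "b = code v"
  using assms code_back by (metis le_imageE)

lemma le_imageI: "(w, v) \<in> le F \<Longrightarrow> (code w, code v) \<in> le_image"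
  unfolding le_image_def by blast

lemma acc_imageI: "(w, v) \<in> acc F \<Longrightarrow> (code w, code v) \<in> acc_image"
  unfolding acc_image_def by blast

lemma acc_imageE:
  assumes "(a, b) \<in> acc_image"
  obtains w v where "(w, v) \<in> acc F" "a = code w" "b = code v"
  using assms unfolding acc_image_def by blast

lemma le_image_trans: "(a, b) \<in> le_image \<Longrightarrow> (b, c) \<in> le_image \<Longrightarrow> (a, c) \<in> le_image"
  using le_imageD le_trans le_worlds le_imageI by (metis le_imageE)

text \<open>The modal step fixes the representatives; the intuitionistic step is then lifted to
  start at the same \<open>w\<close>, and the square is completed in \<open>F\<close>.\<close>

lemma acc_image_forth_up:
  assumes "(a, b) \<in> acc_image" "(a, a') \<in> le_image"
  shows "\<exists>b'. (b, b') \<in> le_image \<and> (a', b') \<in> acc_image"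
proof -
  obtain w v where wv: "(w, v) \<in> acc F" "a = code w" "b = code v"
    using assms(1) by (rule acc_imageE)
  obtain w' where w': "(w, w') \<in> le F" "a' = code w'"
    using assms(2) wv acc_worlds le_imageD by metis
  obtain v' where "(v, v') \<in> le F" "(w', v') \<in> acc F"
    using forth_up wv w' by blast
  then show ?thesis using wv w' le_imageI acc_imageI by blast
qed

lemma acc_image_back_up:
  assumes "(a, b) \<in> acc_image" "(b, b') \<in> le_image"
  shows "\<exists>a'. (a, a') \<in> le_image \<and> (a', b') \<in> acc_image"
proof -
  obtain w v where wv: "(w, v) \<in> acc F" "a = code w" "b = code v"
    using assms(1) by (rule acc_imageE)
  obtain v' where v': "(v, v') \<in> le F" "b' = code v'"
    using assms(2) wv acc_worlds le_imageD by metis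
  obtain w' where "(w, w') \<in> le F" "(w', v') \<in> acc F"
    using back_up wv v' by blast
  then show ?thesis using wv v' le_imageI acc_imageI by blast
qed

text \<open>Squares for single steps are pasted side by side along the path.\<close>

lemma trancl_forth_up:
  "(a, b) \<in> acc_image\<^sup>+ \<Longrightarrow> (a, a') \<in> le_image \<Longrightarrow>
    \<exists>b'. (b, b') \<in> le_image \<and> (a', b') \<in> acc_image\<^sup>+"
proof (induction rule: trancl_induct)
  case (base b)
  then show ?case using acc_image_forth_up by blast
next
  case (step b c)
  then show ?case using acc_image_forth_up by (meson trancl.trancl_into_trancl)
qed

text \<open>Pasting starts from the last square, whose new corner becomes the upper world for the
  rest of the path; hence \<open>b'\<close> varies in the induction.\<close>

lemma trancl_back_up:
  "(a, b) \<in> acc_image\<^sup>+ \<Longrightarrow> (b, b') \<in> le_image \<Longrightarrow>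
    \<exists>a'. (a, a') \<in> le_image \<and> (a', b') \<in> acc_image\<^sup>+"
proof (induction arbitrary: b' rule: trancl_induct)
  case (base b)
  then show ?case using acc_image_back_up by blast
next
  case (step b c)
  then show ?case using acc_image_back_up by (meson trancl.trancl_into_trancl)
qed

lemma acc_image_worlds: "acc_image\<^sup>+ \<subseteq> code ` worlds F \<times> code ` worlds F"
  by (rule trancl_subset_Sigma) (use acc_worlds in \<open>auto simp: acc_image_def\<close>)

lemma GS4_frame_collapse: "GS4_frame collapse"
proof -
  have "preorder_on (worlds collapse) (le collapse)"
    unfolding preorder_on_def refl_on_def
    using le_image_trans le_worlds le_refl le_imageI
    by (auto simp: trans_def le_image_def; blast)
  moreover have "preorder_on (worlds collapse) (acc collapse)"
    unfolding preorder_on_def refl_on_def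
    using acc_image_worlds acc_refl acc_imageI by auto
  moreover have "upward_linear collapse"
    unfolding upward_linear_def
  proof clarsimp
    fix a b c
    assume ab: "(a, b) \<in> le_image" and ac: "(a, c) \<in> le_image" and ncb: "(c, b) \<notin> le_image"
    from ab obtain w v where w: "a = code w" "b = code v" "(w, v) \<in> le F"
      unfolding le_image_def by blast
    \<comment> \<open>Lifting the second step from the same \<open>w\<close> makes linearity of
      \<open>F\<close> applicable to \<open>u\<close> and \<open>v\<close>.\<close>
    then obtain u where "(w, u) \<in> le F" "c = code u"
      using le_imageD ac le_worlds by metis
    then show "(b, c) \<in> le_image" using w ncb linear le_imageI by blast
  qed
  ultimately show ?thesis
    using trancl_forth_up trancl_back_up
    unfolding GS4_frame_def bi_intuitionistic_frame_def infallible_def up_closed_def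
      forth_up_confluent_def back_up_confluent_def
    by auto
qed

section \<open>Truth on the collapse and the finite model\<close>

lemma code_in_collapse_val:
  assumes "w \<in> worlds F" "Var p \<in> \<Sigma>"
  shows "code w \<in> collapse_val p \<longleftrightarrow> w \<in> V p"
proof
  assume "code w \<in> collapse_val p"
  then obtain v where "code w = code v" "v \<in> V p"
    unfolding collapse_val_def by blast
  moreover from this have "v \<in> worlds F"
    using val unfolding valuation_def by blast
  ultimately show "w \<in> V p"
    using assms sat_cong_code[of w v "Var p"] by simp
qed (use assms in \<open>auto simp: collapse_val_def\<close>)

lemma valuation_collapse: "valuation collapse collapse_val"
  unfolding valuation_def up_closed_def
proof (intro allI conjI impI)
  fix p
  show "collapse_val p \<subseteq> worlds collapse"
    using val unfolding collapse_val_def valuation_def by auto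
  fix a b
  assume "a \<in> collapse_val p \<and> (a, b) \<in> le collapse"
  then obtain w where w: "a = code w" "w \<in> V p" "Var p \<in> \<Sigma>" "(code w, b) \<in> le_image"
    unfolding collapse_val_def by auto
  then have "w \<in> worlds F" using val unfolding valuation_def by blast
  then obtain v where v: "(w, v) \<in> le F" "b = code v"
    using le_imageD w by blast
  have "v \<in> V p" using sat_mono[of w "Var p" v] w v by simp
  then show "b \<in> collapse_val p" using v w unfolding collapse_val_def by blast
qed simp

text \<open>Consecutive steps of the path may lift to pairs that do not meet in \<open>F\<close>,
  only in their codes. The diamond formula moves back along each lifted pair, and
  \<open>sat_cong_code\<close> carries it across each change of representative.\<close>

lemma trancl_Dia_back:
  "(a, b) \<in> acc_image\<^sup>+ \<Longrightarrow> \<^bold>\<diamond>\<psi> \<in> \<Sigma> \<Longrightarrow> a = code w \<Longrightarrow> w \<in> worlds F \<Longrightarrow>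
    b = code v \<Longrightarrow> v \<in> worlds F \<Longrightarrow> sat F V v (\<^bold>\<diamond>\<psi>) \<Longrightarrow> sat F V w (\<^bold>\<diamond>\<psi>)"
proof (induction arbitrary: v rule: trancl_induct)
  case (base b)
  then show ?case
    using acc_imageE sat_Dia_acc_back sat_cong_code acc_worlds by metis
next
  case (step b c)
  then obtain u u' where "(u, u') \<in> acc F" "b = code u" "c = code u'"
    using acc_imageE by metis
  then show ?case
    using step sat_Dia_acc_back sat_cong_code acc_worlds by metis
qed

text \<open>Dual to the diamond case: the box formula moves forward along each lifted pair and
  across each change of representative.\<close>

lemma trancl_Box:
  "(a, b) \<in> acc_image\<^sup>+ \<Longrightarrow> \<^bold>\<box>\<psi> \<in> \<Sigma> \<Longrightarrow> a = code w \<Longrightarrow> w \<in> worlds F \<Longrightarrow>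
    b = code v \<Longrightarrow> v \<in> worlds F \<Longrightarrow> sat F V w (\<^bold>\<box>\<psi>) \<Longrightarrow> sat F V v (\<^bold>\<box>\<psi>)"
proof (induction arbitrary: v rule: trancl_induct)
  case (base b)
  then show ?case
    using acc_imageE sat_Box_acc sat_cong_code acc_worlds by metis
next
  case (step b c)
  then obtain u u' where "(u, u') \<in> acc F" "b = code u" "c = code u'"
    using acc_imageE by metis
  then show ?case
    using step sat_Box_acc sat_cong_code acc_worlds by metis
qed

lemma sat_collapse:
  "\<psi> \<in> \<Sigma> \<Longrightarrow> w \<in> worlds F \<Longrightarrow> sat collapse collapse_val (code w) \<psi> \<longleftrightarrow> sat F V w \<psi>"
proof (induction \<psi> arbitrary: w)
  case (Var p)
  then show ?case using code_in_collapse_val by simp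
next
  case Bot
  then show ?case by (simp add: no_fallible)
next
  case (And \<psi> \<chi>)
  then have "\<psi> \<in> \<Sigma>" "\<chi> \<in> \<Sigma>"
    using \<Sigma>_closed[OF And.prems(1)] by (auto intro: subsetD[OF _ self_in_subformulas])
  then show ?case using And by simp
next
  case (Or \<psi> \<chi>)
  then have "\<psi> \<in> \<Sigma>" "\<chi> \<in> \<Sigma>"
    using \<Sigma>_closed[OF Or.prems(1)] by (auto intro: subsetD[OF _ self_in_subformulas])
  then show ?case using Or by simp
next
  case (Imp \<psi> \<chi>)
  then have "\<psi> \<in> \<Sigma>" "\<chi> \<in> \<Sigma>"
    using \<Sigma>_closed[OF Imp.prems(1)] by (auto intro: subsetD[OF _ self_in_subformulas])
  then have IH: "sat collapse collapse_val (code v) \<psi> \<longleftrightarrow> sat F V v \<psi>"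
      "sat collapse collapse_val (code v) \<chi> \<longleftrightarrow> sat F V v \<chi>" if "(w, v) \<in> le F" for v
    using Imp le_worlds[OF that] by auto
  show ?case
  proof
    assume "sat collapse collapse_val (code w) (\<psi> \<^bold>\<rightarrow> \<chi>)"
    then show "sat F V w (\<psi> \<^bold>\<rightarrow> \<chi>)" using IH le_imageI unfolding sat.simps collapse_simps by blast
  next
    assume "sat F V w (\<psi> \<^bold>\<rightarrow> \<chi>)"
    then show "sat collapse collapse_val (code w) (\<psi> \<^bold>\<rightarrow> \<chi>)"
      using IH Imp.prems by (auto elim!: le_imageD)
  qed
next
  case (Dia \<psi>)
  then have "\<psi> \<in> \<Sigma>"
    using \<Sigma>_closed[OF Dia.prems(1)] by (auto intro: subsetD[OF _ self_in_subformulas])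
  then have IH: "sat collapse collapse_val (code v) \<psi> \<longleftrightarrow> sat F V v \<psi>" if "v \<in> worlds F" for v
    using Dia.IH that by auto
  show ?case
  proof
    assume "sat collapse collapse_val (code w) (\<^bold>\<diamond>\<psi>)"
    then obtain b where b: "(code w, b) \<in> acc_image\<^sup>+" "sat collapse collapse_val b \<psi>"
      using le_imageI le_refl Dia.prems unfolding sat.simps collapse_simps by blast
    then obtain v where v: "b = code v" "v \<in> worlds F" using acc_image_worlds by auto
    \<comment> \<open>The formula \<open>\<psi>\<close> itself need not travel back along the path,
      so it is first weakened to its diamond by reflexivity.\<close>
    then have "sat F V v (\<^bold>\<diamond>\<psi>)" using sat_Dia acc_refl IH b by blast
    then show "sat F V w (\<^bold>\<diamond>\<psi>)" using trancl_Dia_back b v Dia.prems by blast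
  next
    assume dia: "sat F V w (\<^bold>\<diamond>\<psi>)"
    show "sat collapse collapse_val (code w) (\<^bold>\<diamond>\<psi>)"
      unfolding sat.simps
    proof (intro allI impI)
      fix a assume "(code w, a) \<in> le collapse"
      then obtain u where u: "(w, u) \<in> le F" "a = code u"
        using le_imageD Dia.prems by auto
      then obtain v where "(u, v) \<in> acc F" "sat F V v \<psi>" using dia by auto
      then show "\<exists>b. (a, b) \<in> acc collapse \<and> sat collapse collapse_val b \<psi>"
        using u IH acc_imageI acc_worlds unfolding collapse_simps by blast
    qed
  qed
next
  case (Box \<psi>)
  then have "\<psi> \<in> \<Sigma>"
    using \<Sigma>_closed[OF Box.prems(1)] by (auto intro: subsetD[OF _ self_in_subformulas])
  then have IH: "sat collapse collapse_val (code v) \<psi> \<longleftrightarrow> sat F V v \<psi>" if "v \<in> worlds F" for v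
    using Box.IH that by auto
  show ?case
  proof
    assume box: "sat collapse collapse_val (code w) (\<^bold>\<box>\<psi>)"
    show "sat F V w (\<^bold>\<box>\<psi>)"
      unfolding sat.simps
    proof (intro allI impI)
      fix u v assume uv: "(w, u) \<in> le F \<and> (u, v) \<in> acc F"
      then have "sat collapse collapse_val (code v) \<psi>"
        using box le_imageI acc_imageI unfolding sat.simps collapse_simps by blast
      then show "sat F V v \<psi>" using IH acc_worlds uv by blast
    qed
  next
    assume box: "sat F V w (\<^bold>\<box>\<psi>)"
    show "sat collapse collapse_val (code w) (\<^bold>\<box>\<psi>)"
      unfolding sat.simps
    proof (intro allI impI)
      fix a b assume ab: "(code w, a) \<in> le collapse \<and> (a, b) \<in> acc collapse"
      then obtain u where u: "(w, u) \<in> le F" "a = code u"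
        using le_imageD Box.prems by auto
      obtain v where v: "b = code v" "v \<in> worlds F" using ab acc_image_worlds by auto
      \<comment> \<open>The box is kept on the way up to \<open>u\<close> and along the modal path
        to \<open>v\<close>; only there does reflexivity discharge it.\<close>
      have "sat F V u (\<^bold>\<box>\<psi>)" using box u sat_mono by blast
      then have "sat F V v (\<^bold>\<box>\<psi>)"
        using trancl_Box ab u v Box.prems(1) le_worlds unfolding collapse_simps by blast
      then show "sat collapse collapse_val b \<psi>" using sat_Box_self IH v by blast
    qed
  qed
qed

end

text \<open>An equivalence for one formula at one world serves falsifiability and satisfiability
  alike; the collapse is taken with the subformulas of \<open>\<phi>\<close> as
  \<open>\<Sigma>\<close>.\<close>

lemma GS4_finite_model:
  fixes F :: "'w frame" and \<phi> :: "'p fm"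
  assumes "GS4_frame F" "valuation F V" "w \<in> worlds F"
  obtains G :: "nat frame" and U v where "GS4_frame G" "finite_frame G" "valuation G U"
    "v \<in> worlds G - fallible G" "sat G U v \<phi> \<longleftrightarrow> sat F V w \<phi>"
proof -
  interpret GS4_filtration F V "subformulas \<phi>"
    using assms finite_subformulas subformulas_trans by unfold_locales auto
  \<comment> \<open>Written as an image of the set of chains, the carrier inherits the finiteness of
    that set.\<close>
  have "code ` worlds F
      = (SOME g :: _ \<Rightarrow> nat. inj_on g (chain_of ` worlds F)) ` chain_of ` worlds F"
    unfolding code_def by auto
  then have "finite_frame collapse" using finite_chains unfolding finite_frame_def by simp
  moreover have "sat collapse collapse_val (code w) \<phi> \<longleftrightarrow> sat F V w \<phi>"
    using sat_collapse self_in_subformulas assms by blast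
  ultimately show ?thesis
    using that[OF GS4_frame_collapse _ valuation_collapse, of "code w"] assms by simp
qed

theorem mainTheorem2:
  fixes \<phi> :: "'p::{countable, infinite} fm"
  shows "((\<exists>F :: 'w frame. GS4_frame F \<and> falsifiable_on F \<phi>) \<longrightarrow>
            (\<exists>G :: nat frame. GS4_frame G \<and> finite_frame G \<and> falsifiable_on G \<phi>)) \<and>
         ((\<exists>F :: 'w frame. GS4_frame F \<and> satisfiable_on F \<phi>) \<longrightarrow>
            (\<exists>G :: nat frame. GS4_frame G \<and> finite_frame G \<and> satisfiable_on G \<phi>))"
  unfolding falsifiable_on_def satisfiable_on_def by (metis GS4_finite_model DiffD1)

end
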